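(* Let $0<s<1$. The $s$-energy of a mass distribution $\mu$ on the Cantor dyadic group $G$ can be expressed as $$I_s(\mu)=\sum_{k=0}^{\infty}\widehat{\phi_s}(k)\,(\widehat{\mu}(k))^2$$ (infinite values are not excluded in this equation).
   Context: The Cantor dyadic group $G$ is the set of all sequences $x=\{x_j\}_{j=1}^\infty$ with $x_j\in\{0,1\}$, with coordinate-wise addition modulo 2, topologized by the subgroups $G_n=\{x\in G: x_j=0,\ 1\le j\le n\}$ ($G_0=G$) as a base of neighborhoods of $0$. Let $\lambda$ be the normalized Haar measure on $G$, $\lambda(G)=1$. For $n\ge 1$ let $K_n^2=G_{n-1}\setminus G_n$ (the coset of $G_n$ consisting of $x$ with $x_1=\dots=x_{n-1}=0$, $x_n=1$), so that $G\setminus\{0\}$ is the disjoint union of the sets $K_n^2$, $n\ge1$. The $s$-kernel is the function $\phi_s$ on $G$ given by $\phi_s(0)=0$ and $\phi_s(x)=2^{s(n-1)}$ if $x\in K_n^2$, $n\ge 1$. A mass distribution on $G$ is a positive finite (Borel) measure $\mu$ on $G$. The $s$-potential of $\mu$ is $\Phi_s(x)=\int_G\phi_s(x-y)\,d\mu(y)$ and its $s$-energy is $I_s(\mu)=\int_G\Phi_s(x)\,d\mu(x)$. Walsh functions: for an integer $k\ge0$ with dyadic expansion $k=\sum_{i\ge 0} k_i2^i$, $k_i\in\{0,1\}$, put $w_k(x)=(-1)^{\sum_{i\ge 0} k_ix_{i+1}}$ (so $w_0\equiv1$). Walsh–Fourier coefficients are $\widehat{\phi_s}(k)=\int_G \phi_s\,w_k\,d\lambda$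 and $\widehat{\mu}(k)=\int_G w_k\,d\mu$.
   Formalization: The formal theorem adds the assumption that μ has no atoms or that I_s(μ)=∞; without it the identity fails (since φ_s(0)=0, the unit mass at 0 has energy 0 but a divergent series), and it fails for every excluded μ. *)

theory Defs
  imports
    "HOL-Probability.Probability"
    "HOL-Library.Function_Algebras"
    "HOL-Library.Z2"
begin

text \<open>
  The Cantor dyadic group is the type \<open>nat \<Rightarrow> bit\<close>: \<open>bit\<close> is the two-element field with the
  discrete topology, group operations on functions are pointwise, and the topology on functions is
  the product topology. Coordinates are numbered from \<open>0\<close>, so the coordinate \<open>x\<^sub>j\<close> (\<open>j \<ge> 1\<close>) of the
  usual notation is \<open>x (j - 1)\<close>.
\<close>

instantiation bit :: discrete_topology
begin

definition open_bit :: "bit set \<Rightarrow> bool"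
  where "open_bit A \<longleftrightarrow> True"

instance
  by standard (simp_all add: open_bit_def)

end

instance bit :: finite
proof
  have "x \<in> {0, 1}" for x :: bit
    by (cases x) simp_all
  then have "(UNIV :: bit set) \<subseteq> {0, 1}"
    by blast
  then show "finite (UNIV :: bit set)"
    by (rule finite_subset) simp
qed

instance bit :: second_countable_topology
proof
  have "countable (UNIV :: bit set set)"
    by (simp add: countable_finite)
  moreover have "open = generate_topology (UNIV :: bit set set)"
    by (auto simp: fun_eq_iff open_bit_def intro: generate_topology.Basis)
  ultimately show "\<exists>B :: bit set set. countable B \<and> open = generate_topology B"
    by blast
qed

type_synonym cantor = "nat \<Rightarrow> bit"

definition cantor_subgroup :: "nat \<Rightarrow> cantor set"
  where "cantor_subgroup n = {x. \<forall>j<n. x j = 0}"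

text \<open>Meaningful for \<open>n \<ge> 1\<close> only.\<close>

definition cantor_shell :: "nat \<Rightarrow> cantor set"
  where "cantor_shell n = cantor_subgroup (n - 1) - cantor_subgroup n"

definition s_kernel :: "real \<Rightarrow> cantor \<Rightarrow> real"
  where "s_kernel s x =
    (if x = 0 then 0 else 2 powr (s * real ((THE n. 1 \<le> n \<and> x \<in> cantor_shell n) - 1)))"

definition mass_distribution :: "cantor measure \<Rightarrow> bool"
  where "mass_distribution \<mu> \<longleftrightarrow> sets \<mu> = sets borel \<and> finite_measure \<mu>"

definition s_potential :: "real \<Rightarrow> cantor measure \<Rightarrow> cantor \<Rightarrow> ennreal"
  where "s_potential s \<mu> x = (\<integral>\<^sup>+ y. ennreal (s_kernel s (x - y)) \<partial>\<mu>)"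

definition s_energy :: "real \<Rightarrow> cantor measure \<Rightarrow> ennreal"
  where "s_energy s \<mu> = (\<integral>\<^sup>+ x. s_potential s \<mu> x \<partial>\<mu>)"

definition normalized_haar :: "cantor measure \<Rightarrow> bool"
  where "normalized_haar H \<longleftrightarrow>
    sets H = sets borel \<and> prob_space H \<and> (\<forall>a. distr H borel (\<lambda>x. a + x) = H)"

text \<open>The \<open>i\<close>-th dyadic digit of \<open>k\<close> is \<open>bit k i\<close>.\<close>

definition walsh :: "nat \<Rightarrow> cantor \<Rightarrow> real"
  where "walsh k x = (- 1) ^ (\<Sum>i | bit k i. of_bool (x i = 1))"

definition walsh_coeff :: "cantor measure \<Rightarrow> (cantor \<Rightarrow> real) \<Rightarrow> nat \<Rightarrow> real"
  where "walsh_coeff H f k = (\<integral>x. f x * walsh k x \<partial>H)"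

definition walsh_coeff_measure :: "cantor measure \<Rightarrow> nat \<Rightarrow> real"
  where "walsh_coeff_measure \<mu> k = (\<integral>x. walsh k x \<partial>\<mu>)"

subsection \<open>Consistency with the usual descriptions\<close>

lemma open_cantor_subgroup: "open (cantor_subgroup n)"
proof -
  have "cantor_subgroup n = (\<Inter>j\<in>{..<n}. (\<lambda>x. x j) -` {0})"
    by (auto simp: cantor_subgroup_def)
  moreover have "open ((\<lambda>x :: cantor. x j) -` {0})" for j
    by (rule open_vimage) (auto simp: discrete_topology_class.open_discrete)
  ultimately show ?thesis
    by (metis finite_lessThan open_INT)
qed

lemma cantor_subgroup_nhds_base:
  assumes "open U" "0 \<in> U"
  shows "\<exists>n. cantor_subgroup n \<subseteq> U"
proof -
  have "openin (product_topology (\<lambda>_. euclidean) UNIV) U"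
    using assms(1) by (simp add: open_fun_def)
  from product_topology_open_contains_basis[OF this assms(2)]
  obtain X where X: "0 \<in> Pi\<^sub>E UNIV X" "finite {i. X i \<noteq> UNIV}" "Pi\<^sub>E UNIV X \<subseteq> U"
    by auto
  obtain n where n: "{i. X i \<noteq> UNIV} \<subseteq> {..<n}"
    using finite_nat_bounded[OF X(2)] by auto
  have "cantor_subgroup n \<subseteq> Pi\<^sub>E UNIV X"
  proof
    fix x assume x: "x \<in> cantor_subgroup n"
    have *: "x i \<in> X i" for i
    proof (cases "X i = UNIV")
      case False
      then have "x i = 0" using n x by (auto simp: cantor_subgroup_def)
      moreover have "(0 :: cantor) i \<in> X i" using X(1) by blast
      ultimately show ?thesis by simp
    qed auto
    show "x \<in> Pi\<^sub>E UNIV X" by (rule PiE_I) (simp_all add: *)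
  qed
  then show ?thesis using X(3) by blast
qed

lemma cantor_shell_iff:
  assumes "1 \<le> n"
  shows "x \<in> cantor_shell n \<longleftrightarrow> (\<forall>j<n - 1. x j = 0) \<and> x (n - 1) = 1"
proof -
  obtain m where m: "n = Suc m" using assms by (cases n) auto
  show ?thesis
    unfolding m by (auto simp: cantor_shell_def cantor_subgroup_def less_Suc_eq)
qed

lemma s_kernel_zero [simp]: "s_kernel s 0 = 0"
  by (simp add: s_kernel_def)

lemma s_kernel_shell:
  assumes n: "1 \<le> n" and x: "x \<in> cantor_shell n"
  shows "s_kernel s x = 2 powr (s * real (n - 1))"
proof -
  have uniq: "m = n" if m: "1 \<le> m" "x \<in> cantor_shell m" for m
  proof -
    have "\<not> m - 1 < n - 1" "\<not> n - 1 < m - 1"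
      using x m(2) unfolding cantor_shell_iff[OF n] cantor_shell_iff[OF m(1)] by auto
    then show ?thesis using n m(1) by linarith
  qed
  have "(THE m. 1 \<le> m \<and> x \<in> cantor_shell m) = n"
  proof (rule the_equality)
    show "1 \<le> n \<and> x \<in> cantor_shell n" using n x by blast
  qed (use uniq in blast)
  moreover have "x \<noteq> 0" using x unfolding cantor_shell_iff[OF n] by auto
  ultimately show ?thesis by (simp add: s_kernel_def)
qed

lemma cantor_shells_cover: "(\<Union>n\<in>{1..}. cantor_shell n) = UNIV - {0}"
proof (rule equalityI)
  show "(\<Union>n\<in>{1..}. cantor_shell n) \<subseteq> UNIV - {0}"
    using cantor_shell_iff by fastforce
next
  show "UNIV - {0} \<subseteq> (\<Union>n\<in>{1..}. cantor_shell n)"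
  proof
    fix x :: cantor assume "x \<in> UNIV - {0}"
    then have "\<exists>i. x i \<noteq> 0" by (auto simp: fun_eq_iff)
    then obtain i where "x i \<noteq> 0" "\<forall>j<i. x j = 0"
      using exists_least_iff[of "\<lambda>i. x i \<noteq> 0"] by auto
    then have "x \<in> cantor_shell (Suc i)"
      by (subst cantor_shell_iff) auto
    then show "x \<in> (\<Union>n\<in>{1..}. cantor_shell n)" by auto
  qed
qed

lemma sets_cantor_borel: "sets (PiM UNIV (\<lambda>_. borel)) = sets (borel :: cantor measure)"
  by (rule sets_PiM_equal_borel)

lemma sets_bit_borel: "sets (borel :: bit measure) = UNIV"
  using borel_open[OF discrete_topology_class.open_discrete] by blast

lemma normalized_haar_exists: "\<exists>H. normalized_haar H"
proof -
  let ?B = "uniform_count_measure (UNIV :: bit set)"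
  let ?H = "PiM UNIV (\<lambda>_ :: nat. ?B)"
  interpret B: prob_space ?B
    by (rule prob_space_uniform_count_measure) auto
  interpret product_prob_space "\<lambda>_ :: nat. ?B" UNIV
    by unfold_locales
  have sB: "sets ?B = sets borel"
    by (simp add: sets_uniform_count_measure sets_bit_borel)
  have sH: "sets ?H = sets borel"
    using sB by (simp add: sets_cantor_borel[symmetric] cong: sets_PiM_cong)
  have inv: "distr ?H borel (\<lambda>x. a + x) = ?H" for a :: cantor
  proof (rule measure_eqI_PiM_infinite)
    have meas: "(\<lambda>x :: cantor. a + x) \<in> measurable ?H ?H"
    proof (rule measurable_PiM_single')
      fix i :: nat
      have "(\<lambda>x. x i) \<in> measurable ?H ?B" by simp
      moreover have "(\<lambda>b. a i + b) \<in> measurable ?B ?B"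
        by (auto simp: measurable_def sets_uniform_count_measure space_uniform_count_measure)
      ultimately have "(\<lambda>b. a i + b) \<circ> (\<lambda>x. x i) \<in> measurable ?H ?B"
        by (rule measurable_comp)
      then show "(\<lambda>x. (a + x) i) \<in> measurable ?H ?B" by (simp add: comp_def)
    qed (auto simp: space_PiM space_uniform_count_measure)
    have meas': "(\<lambda>x :: cantor. a + x) \<in> measurable ?H borel"
      using meas measurable_cong_sets[OF refl sH] by blast
    show "finite_measure (distr ?H borel (\<lambda>x. a + x))"
      using prob_space_distr[OF meas'] by (simp add: prob_space.finite_measure)
    fix J :: "nat set" and A :: "nat \<Rightarrow> bit set"
    assume J: "finite J" "J \<subseteq> UNIV"
    let ?E = "prod_emb UNIV (\<lambda>_. ?B) J (Pi\<^sub>E J A)"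
    let ?A = "\<lambda>i. (\<lambda>b. a i + b) -` A i"
    have E: "?E \<in> sets ?H"
      using J by (intro sets_PiM_I) (auto simp: sets_uniform_count_measure)
    have "(\<lambda>x. a + x) -` ?E \<inter> space ?H = prod_emb UNIV (\<lambda>_. ?B) J (Pi\<^sub>E J ?A)"
      by (auto simp: prod_emb_def space_PiM space_uniform_count_measure PiE_iff)
    then have "emeasure (distr ?H borel (\<lambda>x. a + x)) ?E
        = emeasure ?H (prod_emb UNIV (\<lambda>_. ?B) J (Pi\<^sub>E J ?A))"
      using E sH meas' by (simp add: emeasure_distr)
    also have "\<dots> = (\<Prod>i\<in>J. emeasure ?B (?A i))"
      using J by (intro emeasure_PiM_emb) (auto simp: sets_uniform_count_measure)
    also have "\<dots> = (\<Prod>i\<in>J. emeasure ?B (A i))"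
    proof (rule prod.cong[OF refl])
      fix i assume "i \<in> J"
      have "bij (\<lambda>b. a i + b)"
        by (rule bij_betw_byWitness[where f' = "\<lambda>b. b - a i"]) auto
      then have "card (?A i) = card (A i)"
        by (simp add: card_vimage_inj bij_def)
      then show "emeasure ?B (?A i) = emeasure ?B (A i)"
        by (simp add: emeasure_uniform_count_measure)
    qed
    also have "\<dots> = emeasure ?H ?E"
      using J by (intro emeasure_PiM_emb[symmetric]) (auto simp: sets_uniform_count_measure)
    finally show "emeasure (distr ?H borel (\<lambda>x. a + x)) ?E = emeasure ?H ?E" .
  qed (simp_all add: sH)
  have "prob_space ?H" by unfold_locales
  with sH inv show ?thesis unfolding normalized_haar_def by blast
qed

subsection \<open>Failure of the energy identity in the presence of atoms\<close>

lemma borel_measurable_coordinate: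
  "(\<lambda>x :: cantor. f (x i)) \<in> borel_measurable borel" for f :: "bit \<Rightarrow> 'a::topological_space"
proof -
  have "(\<lambda>x :: cantor. x i) \<in> borel_measurable borel"
    by (intro borel_measurable_continuous_onI continuous_on_product_coordinates)
  moreover have "f \<in> borel_measurable borel"
    by (simp add: measurable_def sets_bit_borel)
  ultimately show ?thesis by (rule measurable_compose)
qed

lemma finite_bits: "finite {i. bit (k :: nat) i}"
proof (rule finite_subset)
  show "{i. bit k i} \<subseteq> {..k}"
  proof
    fix i assume "i \<in> {i. bit k i}"
    then have "bit k i" by simp
    then have "2 ^ i \<le> k" by (metis bit_nat_def bit_iff_odd div_less even_zero not_le)
    then show "i \<in> {..k}" using order.strict_trans2[OF less_exp[of i]] by fastforce
  qed
qed simp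

lemma walsh_prod: "walsh k x = (\<Prod>i | bit k i. if x i = 1 then - 1 else 1)"
  unfolding walsh_def by (subst power_sum) (auto intro!: prod.cong)

lemma walsh_measurable: "walsh k \<in> borel_measurable borel"
  unfolding walsh_prod[abs_def]
  by (intro borel_measurable_prod borel_measurable_coordinate[of "\<lambda>b. if b = 1 then - 1 else 1"])

lemma abs_walsh: "\<bar>walsh k x\<bar> = 1"
  unfolding walsh_def by (simp add: power_abs)

lemma bits_add_power:
  assumes "k < 2 ^ N" shows "{i. bit (k + 2 ^ N :: nat) i} = insert N {i. bit k i}" "\<not> bit k N"
proof -
  show n: "\<not> bit k N" using assms by (simp add: bit_iff_odd)
  have "Bit_Operations.and k (2 ^ N) = 0"
    using n by (auto simp: bit_eq_iff[of "Bit_Operations.and k (2 ^ N)"] bit_simps)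
  then have "k + 2 ^ N = Bit_Operations.or k (2 ^ N)"
    by (rule disjunctive_add_eq_or)
  then show "{i. bit (k + 2 ^ N :: nat) i} = insert N {i. bit k i}"
    by (auto simp: bit_simps)
qed

lemma dirichlet: "(\<Sum>k<2 ^ N. walsh k x) = 2 ^ N * indicator (cantor_subgroup N) x"
proof (induction N)
  case 0
  then show ?case by (simp add: cantor_subgroup_def walsh_def)
next
  case (Suc N)
  have "walsh (k + 2 ^ N) x = (if x N = 1 then - 1 else 1) * walsh k x" if "k < 2 ^ N" for k
    unfolding walsh_prod bits_add_power(1)[OF that]
    by (subst prod.insert) (use finite_bits bits_add_power(2)[OF that] in auto)
  then have "(\<Sum>k<2 ^ N. walsh (k + 2 ^ N) x) = (if x N = 1 then - 1 else 1) * (\<Sum>k<2 ^ N. walsh k x)"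
    by (simp add: sum_distrib_left)
  moreover have "(\<Sum>k<2 ^ Suc N. walsh k x) = (\<Sum>k<2 ^ N. walsh k x) + (\<Sum>k<2 ^ N. walsh (k + 2 ^ N) x)"
    using sum.shift_bounds_nat_ivl[of "\<lambda>k. walsh k x" 0 "2 ^ N" "2 ^ N"]
      sum.atLeastLessThan_concat[of 0 "2 ^ N" "2 ^ N + 2 ^ N" "\<lambda>k. walsh k x"]
    by (simp add: mult_2 lessThan_atLeast0)
  ultimately show ?case using Suc
    by (auto simp: indicator_def cantor_subgroup_def less_Suc_eq)
qed

lemma cantor_subgroup_sets: "cantor_subgroup n \<in> sets borel"
  by (simp add: open_cantor_subgroup)

lemma haar_subgroup:
  assumes "normalized_haar H" shows "emeasure H (cantor_subgroup n) = ennreal (1 / 2 ^ n)"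
proof (induction n)
  interpret prob_space H using assms by (simp add: normalized_haar_def)
  have sH [simp]: "sets H = sets borel" using assms by (simp add: normalized_haar_def)
  case 0
  have "cantor_subgroup 0 = space H"
    using sets_eq_imp_space_eq[OF sH] by (auto simp: cantor_subgroup_def)
  then show ?case by (simp add: emeasure_space_1)
next
  case (Suc n)
  interpret prob_space H using assms by (simp add: normalized_haar_def)
  have sH [simp]: "sets H = sets borel" using assms by (simp add: normalized_haar_def)
  have sp: "space H = UNIV" using sets_eq_imp_space_eq[OF sH] by simp
  define e :: cantor where "e = (\<lambda>i. if i = n then 1 else 0)"
  let ?S = "cantor_subgroup (Suc n)"
  let ?T = "(\<lambda>x. e + x) -` ?S"
  have mT: "(\<lambda>x. e + x) \<in> measurable H borel"
  proof -
    have "continuous_on UNIV (\<lambda>x :: cantor. e + x)"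
    proof (rule continuous_on_coordinatewise_then_product)
      fix i
      have "continuous_on UNIV ((\<lambda>b. e i + b) \<circ> (\<lambda>x :: cantor. x i))"
        by (intro continuous_on_compose continuous_on_product_coordinates)
          (simp add: continuous_on_open_vimage discrete_topology_class.open_discrete)
      then show "continuous_on UNIV (\<lambda>x :: cantor. (e + x) i)" by (simp add: comp_def)
    qed
    then show ?thesis using borel_measurable_continuous_onI measurable_cong_sets[OF sH refl] by blast
  qed
  have "emeasure H ?S = emeasure (distr H borel (\<lambda>x. e + x)) ?S"
    using assms by (simp add: normalized_haar_def)
  also have "\<dots> = emeasure H ?T"
    using mT by (simp add: emeasure_distr sp cantor_subgroup_sets)
  finally have eq: "emeasure H ?T = emeasure H ?S" by simp
  have T: "?T = {x. (\<forall>j<n. x j = 0) \<and> x n = 1}"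
  proof -
    have "1 + b = 0 \<longleftrightarrow> b = 1" for b :: bit by (cases b) auto
    then show ?thesis by (auto simp: cantor_subgroup_def e_def less_Suc_eq)
  qed
  have "cantor_subgroup n = ?S \<union> ?T" "?S \<inter> ?T = {}"
    unfolding T by (auto simp: cantor_subgroup_def less_Suc_eq)
  moreover have "?T \<in> sets H" using measurable_sets[OF mT cantor_subgroup_sets[of "Suc n"]] by (simp add: sp)
  ultimately have "emeasure H (cantor_subgroup n) = emeasure H ?S + emeasure H ?S"
    by (metis plus_emeasure cantor_subgroup_sets eq sH)
  then have "ennreal (1 / 2 ^ n) = emeasure H ?S + emeasure H ?S" by (simp add: Suc)
  moreover obtain r where r: "emeasure H ?S = ennreal r" "0 \<le> r"
    using emeasure_finite[of ?S] by (cases "emeasure H ?S") (auto simp: top_unique)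
  ultimately have "ennreal (1 / 2 ^ n) = ennreal (r + r)"
    using r by (simp del: ennreal_plus add: ennreal_plus[symmetric])
  then have "1 / 2 ^ n = r + r" using r(2) by (subst (asm) ennreal_inj) auto
  then show ?case using r by (simp add: field_simps)
qed

lemma s_kernel_suminf:
  assumes "s > 0"
  shows "x \<noteq> 0 \<Longrightarrow> s_kernel s x \<ge> 1" "s_kernel s x \<ge> 0"
    "ennreal (s_kernel s x) \<le> (\<Sum>n. ennreal (2 powr (s * real n)) * indicator (cantor_subgroup n) x)"
proof -
  have *: "s_kernel s x \<ge> 1 \<and> ennreal (s_kernel s x) \<le>
     (\<Sum>n. ennreal (2 powr (s * real n)) * indicator (cantor_subgroup n) x)" if "x \<noteq> 0"
  proof -
    have "x \<in> (\<Union>n\<in>{1..}. cantor_shell n)" using that unfolding cantor_shells_cover by simp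
    then obtain n where n: "1 \<le> n" "x \<in> cantor_shell n" by auto
    then have "x \<in> cantor_subgroup (n - 1)" by (simp add: cantor_shell_def)
    then have "ennreal (s_kernel s x) = (\<lambda>n. ennreal (2 powr (s * real n)) * indicator (cantor_subgroup n) x) (n - 1)"
      by (simp add: s_kernel_shell[OF n])
    also have "\<dots> \<le> (\<Sum>n. ennreal (2 powr (s * real n)) * indicator (cantor_subgroup n) x)"
      using sum_le_suminf[OF summableI, of "{n - 1}"] by simp
    finally show ?thesis using s_kernel_shell[OF n] assms by (simp add: ge_one_powr_ge_zero)
  qed
  show "x \<noteq> 0 \<Longrightarrow> s_kernel s x \<ge> 1" using * by auto
  show "s_kernel s x \<ge> 0" using * by (cases "x = 0") auto
  show "ennreal (s_kernel s x) \<le> (\<Sum>n. ennreal (2 powr (s * real n)) * indicator (cantor_subgroup n) x)"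
    using * by (cases "x = 0") auto
qed

lemma s_kernel_measurable: "s_kernel s \<in> borel_measurable borel"
proof -
  have eq: "s_kernel s = (\<lambda>x. \<Sum>n. 2 powr (s * real n) * indicator (cantor_shell (Suc n)) x)"
  proof
    fix x
    show "s_kernel s x = (\<Sum>n. 2 powr (s * real n) * indicator (cantor_shell (Suc n)) x)"
    proof (cases "x = 0")
      case True
      then have "x \<notin> cantor_shell (Suc n)" for n
        by (simp add: cantor_shell_def cantor_subgroup_def)
      then show ?thesis using True by simp
    next
      case False
      then have "x \<in> (\<Union>n\<in>{1..}. cantor_shell n)" unfolding cantor_shells_cover by simp
      then obtain m where m: "1 \<le> m" "x \<in> cantor_shell m" by auto
      then obtain n where n: "x \<in> cantor_shell (Suc n)" by (cases m) auto
      have uniq: "m = n" if "x \<in> cantor_shell (Suc m)" for m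
      proof (rule ccontr)
        assume "m \<noteq> n"
        then consider "m < n" | "n < m" by linarith
        then show False using that n by cases (auto simp: cantor_shell_iff)
      qed
      have "indicator (cantor_shell (Suc m)) x = (0 :: real)" if "m \<noteq> n" for m
        using uniq that by (auto simp: indicator_def)
      then have "(\<Sum>n. 2 powr (s * real n) * indicator (cantor_shell (Suc n)) x)
        = (\<Sum>m\<in>{n}. 2 powr (s * real m) * indicator (cantor_shell (Suc m)) x)"
        by (intro suminf_finite) simp_all
      then show ?thesis using n s_kernel_shell[of "Suc n" x s] by simp
    qed
  qed
  have [measurable]: "cantor_shell n \<in> sets borel" for n
    unfolding cantor_shell_def using cantor_subgroup_sets by blast
  show ?thesis unfolding eq by measurable
qed

lemma s_kernel_integrable:
  assumes "0 < s" "s < 1" "normalized_haar H" shows "integrable H (s_kernel s)"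
proof (rule integrableI_nonneg)
  have sH [measurable_cong]: "sets H = sets borel" using assms by (simp add: normalized_haar_def)
  show "s_kernel s \<in> borel_measurable H"
    using s_kernel_measurable measurable_cong_sets[OF sH refl] by blast
  show "AE x in H. 0 \<le> s_kernel s x" using s_kernel_suminf(2)[OF assms(1)] by simp
  have [measurable]: "cantor_subgroup n \<in> sets borel" for n by (rule cantor_subgroup_sets)
  have "(\<integral>\<^sup>+ x. ennreal (s_kernel s x) \<partial>H)
    \<le> (\<integral>\<^sup>+ x. (\<Sum>n. ennreal (2 powr (s * real n)) * indicator (cantor_subgroup n) x) \<partial>H)"
    by (intro nn_integral_mono s_kernel_suminf assms)
  also have "\<dots> = (\<Sum>n. \<integral>\<^sup>+ x. ennreal (2 powr (s * real n)) * indicator (cantor_subgroup n) x \<partial>H)"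
    by (rule nn_integral_suminf) measurable
  also have "\<dots> = (\<Sum>n. ennreal ((2 powr (s - 1)) ^ n))"
  proof (rule suminf_cong)
    fix n
    have "(2 :: real) powr (s * real n) * (1 / 2 ^ n) = (2 powr (s - 1)) ^ n"
    proof -
      have "(2 powr (s - 1)) ^ n = (2 :: real) powr ((s - 1) * real n)"
        by (simp add: powr_realpow[symmetric] powr_powr)
      also have "\<dots> = 2 powr (s * real n) / 2 powr real n"
        by (simp add: powr_diff[symmetric] algebra_simps)
      finally show ?thesis by (simp add: powr_realpow)
    qed
    moreover have "(\<integral>\<^sup>+ x. ennreal (2 powr (s * real n)) * indicator (cantor_subgroup n) x \<partial>H)
      = ennreal (2 powr (s * real n)) * ennreal (1 / 2 ^ n)"
      by (subst nn_integral_cmult_indicator) (simp_all add: sH haar_subgroup[OF assms(3)])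
    ultimately show "(\<integral>\<^sup>+ x. ennreal (2 powr (s * real n)) * indicator (cantor_subgroup n) x \<partial>H) = ennreal ((2 powr (s - 1)) ^ n)"
      by (metis ennreal_mult' powr_ge_zero)
  qed
  also have "\<dots> < \<infinity>"
  proof -
    have "(2 :: real) powr (s - 1) < 1" using assms powr_less_mono[of "s - 1" 0 2] by simp
    then have "summable (\<lambda>n. (2 powr (s - 1) :: real) ^ n)" by (intro summable_geometric) simp
    then show ?thesis by (subst suminf_ennreal2) auto
  qed
  finally show "(\<integral>\<^sup>+ x. ennreal (s_kernel s x) \<partial>H) < \<infinity>" .
qed

text \<open>
  Because \<open>s_kernel s 0 = 0\<close>, the identity
  \<open>I\<^sub>s(\<mu>) = (\<Sum>k. \<phi>\<^sub>s^(k) \<mu>^(k)\<^sup>2)\<close> is not true for all mass distributions: an atom of \<open>\<mu>\<close> contributes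
  nothing of its own to the energy, whereas it forces the series to diverge to \<open>\<infinity>\<close>. Hence the
  identity holds for \<open>\<mu>\<close> if and only if \<open>\<mu>\<close> has no atoms or \<open>s_energy s \<mu> = \<infinity>\<close>, and the theorem
  assumes this disjunction. The unit mass at \<open>0\<close> is the simplest example of the failure.
\<close>

lemma dirac_counterexample:
  assumes "0 < s" "s < 1" "normalized_haar H"
  defines "\<mu> \<equiv> return borel (0 :: cantor)"
  shows "mass_distribution \<mu>" "s_energy s \<mu> = 0"
    "\<not> (\<lambda>k. ereal (walsh_coeff H (s_kernel s) k * (walsh_coeff_measure \<mu> k)\<^sup>2))
      sums enn2ereal (s_energy s \<mu>)"
proof -
  interpret prob_space H using assms by (simp add: normalized_haar_def)
  have sH [measurable_cong]: "sets H = sets borel" using assms by (simp add: normalized_haar_def)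
  show "mass_distribution \<mu>"
    unfolding mass_distribution_def \<mu>_def
    by (simp add: prob_space_return prob_space.finite_measure)
  have [measurable]: "s_kernel s \<in> borel_measurable borel" by (rule s_kernel_measurable)
  have s0 [measurable]: "{0 :: cantor} \<in> sets borel"
  proof -
    have "{0 :: cantor} = (\<Inter>n. cantor_subgroup n)"
      by (auto simp: cantor_subgroup_def fun_eq_iff) (metis lessI)
    moreover have "(\<Inter>n. cantor_subgroup n) \<in> sets borel"
      by (intro sets.countable_INT) (auto simp: cantor_subgroup_sets)
    ultimately show ?thesis by simp
  qed
  have ae: "AE x in \<mu>. x = 0"
    using s0 unfolding \<mu>_def by (subst AE_return) (auto simp: pred_def)
  have "s_potential s \<mu> 0 = (\<integral>\<^sup>+ y. 0 \<partial>\<mu>)"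
    unfolding s_potential_def by (rule nn_integral_cong_AE) (use ae in auto)
  then have p0: "s_potential s \<mu> 0 = 0" by simp
  have "s_energy s \<mu> = (\<integral>\<^sup>+ y. 0 \<partial>\<mu>)"
    unfolding s_energy_def by (rule nn_integral_cong_AE) (use ae p0 in auto)
  then show e: "s_energy s \<mu> = 0" by simp
  have mu: "walsh_coeff_measure \<mu> k = 1" for k
    unfolding walsh_coeff_measure_def \<mu>_def
    by (subst integral_return) (simp_all add: walsh_measurable walsh_def)
  have iw: "integrable H (\<lambda>x. s_kernel s x * walsh k x)" for k
  proof (rule Bochner_Integration.integrable_bound[OF s_kernel_integrable[OF assms(1-3)]])
    have [measurable]: "walsh k \<in> borel_measurable borel" by (rule walsh_measurable)
    show "(\<lambda>x. s_kernel s x * walsh k x) \<in> borel_measurable H" by measurable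
  qed (simp add: abs_mult abs_walsh)
  have [measurable]: "cantor_subgroup n \<in> sets borel" for n by (rule cantor_subgroup_sets)
  have H0: "emeasure H {0} = 0"
  proof -
    have "emeasure H {0} \<le> ennreal (1 / 2 ^ n)" for n
      using emeasure_mono[of "{0}" "cantor_subgroup n" H]
      by (simp add: haar_subgroup[OF assms(3)] sH cantor_subgroup_sets) (simp add: cantor_subgroup_def)
    moreover have "(\<lambda>n. ennreal (1 / 2 ^ n)) \<longlonglongrightarrow> ennreal 0"
      by (intro tendsto_ennrealI) real_asymp
    ultimately have "emeasure H {0} \<le> ennreal 0"
      by (intro LIMSEQ_le_const) auto
    then show ?thesis by simp
  qed
  have ge: "1 \<le> (\<Sum>k<2 ^ N. walsh_coeff H (s_kernel s) k)" for N
  proof -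
    have ae0: "AE x in H. x \<noteq> 0"
      using H0 by (intro AE_I[where N = "{0}"]) (auto simp: sH)
    have "(1 :: real) = (\<integral>x. 2 ^ N * indicator (cantor_subgroup N) x \<partial>H)"
      using haar_subgroup[OF assms(3), of N]
      by (simp add: measure_def sets_eq_imp_space_eq[OF sH])
    also have "\<dots> \<le> (\<integral>x. s_kernel s x * (2 ^ N * indicator (cantor_subgroup N) x) \<partial>H)"
    proof (rule integral_mono_AE)
      have "integrable H (\<lambda>x. \<Sum>k<2 ^ N. s_kernel s x * walsh k x)"
        by (intro Bochner_Integration.integrable_sum iw)
      then show "integrable H (\<lambda>x. s_kernel s x * (2 ^ N * indicator (cantor_subgroup N) x))"
        by (simp add: sum_distrib_left[symmetric] dirichlet)
      show "AE x in H. (2 :: real) ^ N * indicator (cantor_subgroup N) x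
         \<le> s_kernel s x * (2 ^ N * indicator (cantor_subgroup N) x)"
        using ae0
      proof eventually_elim
        case (elim x)
        show ?case using s_kernel_suminf(1)[OF assms(1) elim]
          by (simp add: indicator_def)
      qed
      show "integrable H (\<lambda>x. (2 :: real) ^ N * indicator (cantor_subgroup N) x)"
        by (intro integrable_mult_right integrable_real_indicator)
          (simp_all add: sH cantor_subgroup_sets less_top[symmetric])
    qed
    also have "\<dots> = (\<integral>x. (\<Sum>k<2 ^ N. s_kernel s x * walsh k x) \<partial>H)"
      by (simp add: sum_distrib_left[symmetric] dirichlet)
    also have "\<dots> = (\<Sum>k<2 ^ N. walsh_coeff H (s_kernel s) k)"
      unfolding walsh_coeff_def by (intro Bochner_Integration.integral_sum iw)
    finally show ?thesis .
  qed
  show "\<not> (\<lambda>k. ereal (walsh_coeff H (s_kernel s) k * (walsh_coeff_measure \<mu> k)\<^sup>2))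
      sums enn2ereal (s_energy s \<mu>)"
  proof
    assume "(\<lambda>k. ereal (walsh_coeff H (s_kernel s) k * (walsh_coeff_measure \<mu> k)\<^sup>2))
      sums enn2ereal (s_energy s \<mu>)"
    then have "(\<lambda>n. \<Sum>k<n. ereal (walsh_coeff H (s_kernel s) k)) \<longlonglongrightarrow> 0"
      by (simp add: sums_def mu e zero_ennreal.rep_eq)
    moreover have "filterlim (\<lambda>N :: nat. 2 ^ N :: nat) sequentially sequentially"
      by (rule filterlim_at_top_mono[OF filterlim_ident]) (simp add: less_imp_le)
    ultimately have "(\<lambda>N. \<Sum>k<2 ^ N. ereal (walsh_coeff H (s_kernel s) k)) \<longlonglongrightarrow> 0"
      by (rule filterlim_compose)
    moreover have "1 \<le> (\<Sum>k<2 ^ N. ereal (walsh_coeff H (s_kernel s) k))" for N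
      using ge[of N] by (simp add: one_ereal_def)
    ultimately have "(1 :: ereal) \<le> 0"
      by (intro LIMSEQ_le_const[where X = "\<lambda>N. \<Sum>k<2 ^ N. ereal (walsh_coeff H (s_kernel s) k)"]) auto
    then show False by simp
  qed
qed

end

theory Submission
  imports Defs
begin

text \<open>
  With \<open>r = 2 powr (s - 1)\<close>, the Walsh coefficients of the kernel are constant and nonnegative on each block
  \<open>2^N \<le> k < 2^(N+1)\<close>, so the series has nonnegative terms and its partial sums may be taken along
  powers of two. The partial sum of the Walsh series of the kernel up to \<open>2^N\<close> is the kernel itself
  outside \<open>G\<^sub>N\<close> and its average \<open>2 powr (s * N) / (2 * (1 - r))\<close> on \<open>G\<^sub>N\<close>; integrating it
  at \<open>x - y\<close> against \<open>\<mu> \<Otimes> \<mu>\<close> gives the partial sum of the energy series. These averages converge to the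
  kernel and are bounded by a multiple of it away from \<open>0\<close>, so Fatou's lemma settles the case of
  infinite energy, and dominated convergence off the (null) diagonal the case of no atoms.
\<close>

section \<open>The kernel and the Walsh functions relative to the subgroups\<close>

lemma cantor_subgroup_Suc_iff: "x \<in> cantor_subgroup (Suc N) \<longleftrightarrow> x \<in> cantor_subgroup N \<and> x N = 0"
  by (auto simp: cantor_subgroup_def less_Suc_eq)

lemma eventually_notin_cantor_subgroup:
  assumes "z \<noteq> 0"
  shows "\<forall>\<^sub>F N in sequentially. z \<notin> cantor_subgroup N"
proof -
  obtain i where "z i \<noteq> 0"
    using assms by (auto simp: fun_eq_iff)
  then have "z \<notin> cantor_subgroup N" if "Suc i \<le> N" for N
    using that unfolding cantor_subgroup_def by (force simp: Suc_le_eq)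
  then show ?thesis
    by (auto simp: eventually_sequentially)
qed

text \<open>Coordinates count from 0 and shells from 1: such an \<open>x\<close> lies in shell
  \<open>Suc N\<close>, whose exponent is \<open>s * N\<close>.\<close>

lemma s_kernel_boundary:
  assumes "x \<in> cantor_subgroup N" "x N \<noteq> 0"
  shows "s_kernel s x = 2 powr (s * real N)"
  using s_kernel_shell[of "Suc N" x s] assms by (simp add: cantor_shell_def cantor_subgroup_Suc_iff)

text \<open>The first nonzero coordinate has an index \<open>i\<close> at least \<open>N\<close>,
  and \<open>2 powr (s * i)\<close> grows with \<open>i\<close>. This later bounds the averages on
  \<open>G_N\<close> by a multiple of the kernel.\<close>

lemma s_kernel_ge:
  assumes "0 < s" "x \<in> cantor_subgroup N" "x \<noteq> 0"
  shows "2 powr (s * real N) \<le> s_kernel s x"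
proof -
  have "\<exists>i. x i \<noteq> 0"
    using assms(3) by (auto simp: fun_eq_iff)
  then obtain i where i: "x i \<noteq> 0" "\<forall>j<i. x j = 0"
    using exists_least_iff[of "\<lambda>i. x i \<noteq> 0"] by auto
  have "N \<le> i"
    using i(1) assms(2) by (auto simp: cantor_subgroup_def not_less[symmetric])
  moreover have "s_kernel s x = 2 powr (s * real i)"
    using i by (intro s_kernel_boundary) (auto simp: cantor_subgroup_def)
  ultimately show ?thesis
    using assms(1) by simp
qed

text \<open>The kernel sees only the first nonzero coordinate. For \<open>x\<close> outside
  \<open>G_N\<close> its index is below \<open>N\<close>, where \<open>e\<close> vanishes.\<close>

lemma s_kernel_add_left:
  assumes e: "e \<in> cantor_subgroup N" and x: "x \<notin> cantor_subgroup N"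
  shows "s_kernel s (e + x) = s_kernel s x"
proof -
  have "\<exists>i. x i \<noteq> 0"
    using x by (auto simp: cantor_subgroup_def)
  then obtain i where i: "x i \<noteq> 0" "\<forall>j<i. x j = 0"
    using exists_least_iff[of "\<lambda>i. x i \<noteq> 0"] by auto
  have "i < N"
  proof (rule ccontr)
    assume "\<not> i < N"
    then have "x \<in> cantor_subgroup N"
      using i(2) by (simp add: cantor_subgroup_def)
    with x show False
      by contradiction
  qed
  then have "e j = 0" if "j \<le> i" for j
    using e that by (auto simp: cantor_subgroup_def)
  then have "s_kernel s (e + x) = 2 powr (s * real i)"
    using i by (intro s_kernel_boundary) (auto simp: cantor_subgroup_def)
  moreover have "s_kernel s x = 2 powr (s * real i)"
    using i by (intro s_kernel_boundary) (auto simp: cantor_subgroup_def)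
  ultimately show ?thesis
    by simp
qed

lemma cantor_subgroup_add_left_iff:
  "e \<in> cantor_subgroup N \<Longrightarrow> e + x \<in> cantor_subgroup N \<longleftrightarrow> x \<in> cantor_subgroup N"
  by (auto simp: cantor_subgroup_def)

lemma walsh_add: "walsh k (x + y) = walsh k x * walsh k y"
proof -
  have "(if a + b = 1 then - 1 else 1) = (if a = 1 then - 1 else 1) * (if b = 1 then - 1 else (1 :: real))"
    for a b :: bit
    by (cases a; cases b) auto
  then show ?thesis
    by (simp add: walsh_prod prod.distrib)
qed

text \<open>Every element has order at most two. Hence \<open>walsh k (x - y)\<close> factors
  through \<open>walsh_add\<close>.\<close>

lemma cantor_diff_eq_add: "x - y = x + (y :: cantor)"
proof -
  have "a - b = a + b" for a b :: bit
    by (cases a; cases b) auto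
  then show ?thesis
    by (auto simp: fun_eq_iff)
qed

lemma walsh_add_power:
  assumes "j < 2 ^ N"
  shows "walsh (j + 2 ^ N) x = (if x N = 1 then - 1 else 1) * walsh j x"
  unfolding walsh_prod bits_add_power(1)[OF assms]
  by (subst prod.insert) (use finite_bits bits_add_power(2)[OF assms] in auto)

text \<open>All binary digits of \<open>j\<close> sit at positions below \<open>N\<close>, where
  \<open>x\<close> is zero.\<close>

lemma walsh_eq_1:
  assumes "j < 2 ^ N" "x \<in> cantor_subgroup N"
  shows "walsh j x = 1"
proof -
  have "i < N" if "bit j i" for i
  proof (rule ccontr)
    assume "\<not> i < N"
    then have "j < 2 ^ i"
      using assms(1) by (meson not_less order_less_le_trans one_le_numeral power_increasing)
    then show False
      using that by (simp add: bit_iff_odd)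
  qed
  then show ?thesis
    using assms(2) by (auto simp: walsh_prod cantor_subgroup_def intro!: prod.neutral)
qed

lemma measurable_cantor_add [measurable]:
  "(\<lambda>x. a + x) \<in> borel_measurable (borel :: cantor measure)"
proof (rule borel_measurable_continuous_onI, rule continuous_on_coordinatewise_then_product)
  fix i
  have "continuous_on UNIV ((\<lambda>b. a i + b) \<circ> (\<lambda>x :: cantor. x i))"
    by (intro continuous_on_compose continuous_on_product_coordinates)
      (simp add: continuous_on_open_vimage discrete_topology_class.open_discrete)
  then show "continuous_on UNIV (\<lambda>x :: cantor. (a + x) i)"
    by (simp add: comp_def)
qed

text \<open>The left side is the kernel value on shell \<open>Suc N\<close> times the Haar measure
  of \<open>G_N\<close>; this is where the geometric ratio \<open>2 powr (s - 1)\<close> comes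
  from.\<close>

lemma powr_ratio: "2 powr (s * real N) / 2 ^ N = (2 powr (s - 1)) ^ N" for s :: real
proof -
  have "(2 powr (s - 1)) ^ N = (2 :: real) powr ((s - 1) * real N)"
    by (simp add: powr_realpow[symmetric] powr_powr)
  also have "\<dots> = 2 powr (s * real N) / 2 powr real N"
    by (simp add: powr_diff[symmetric] algebra_simps)
  finally show ?thesis
    by (simp add: powr_realpow)
qed

lemma ratio_bounds:
  fixes s :: real
  assumes "0 < s" "s < 1"
  shows "1 / 2 < 2 powr (s - 1)" "2 powr (s - 1) < (1 :: real)"
  using assms powr_less_mono[of "s - 1" 0 2] powr_less_mono[of "-1" "s - 1" 2]
  by (simp_all add: powr_minus)

section \<open>Walsh coefficients of the kernel\<close>

context
  fixes H :: "cantor measure" and s :: real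
  assumes H: "normalized_haar H" and s: "0 < s" "s < 1"
begin

lemma sets_haar [measurable_cong]: "sets H = sets borel"
  using H by (simp add: normalized_haar_def)

lemma haar_subgroup_measure: "measure H (cantor_subgroup N) = 1 / 2 ^ N"
  by (simp add: measure_def haar_subgroup[OF H])

lemma integrable_haar_subgroup: "integrable H (indicator (cantor_subgroup N) :: cantor \<Rightarrow> real)"
  by (intro integrable_real_indicator) (simp_all add: sets_haar cantor_subgroup_sets haar_subgroup[OF H])

lemma integral_haar_add:
  fixes f :: "cantor \<Rightarrow> real"
  assumes [measurable]: "f \<in> borel_measurable borel"
  shows "(\<integral>x. f (a + x) \<partial>H) = (\<integral>x. f x \<partial>H)"
proof -
  have "(\<integral>x. f x \<partial>H) = (\<integral>x. f x \<partial>distr H borel (\<lambda>x. a + x))"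
    using H by (simp add: normalized_haar_def)
  also have "\<dots> = (\<integral>x. f (a + x) \<partial>H)"
    by (rule integral_distr) measurable
  finally show ?thesis
    by simp
qed

lemma integrable_s_kernel_mult:
  assumes "f \<in> borel_measurable borel" "\<And>x. \<bar>f x\<bar> \<le> 1"
  shows "integrable H (\<lambda>x. s_kernel s x * f x)"
proof (rule Bochner_Integration.integrable_bound[OF s_kernel_integrable[OF s H]])
  have [measurable]: "f \<in> borel_measurable borel" "s_kernel s \<in> borel_measurable borel"
    using assms(1) s_kernel_measurable by auto
  show "(\<lambda>x. s_kernel s x * f x) \<in> borel_measurable H"
    by measurable
  show "AE x in H. norm (s_kernel s x * f x) \<le> norm (s_kernel s x)"
    using assms(2) by (simp add: abs_mult mult_left_le)
qed

lemma integrable_s_kernel_subgroup: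
  "integrable H (\<lambda>x. s_kernel s x * indicator (cantor_subgroup N) x)"
  by (intro integrable_s_kernel_mult borel_measurable_indicator cantor_subgroup_sets)
    (auto simp: indicator_def)

text \<open>Splitting off the shell between \<open>G_N\<close> and \<open>G_(N+1)\<close> gives a
  recursion with increment \<open>r ^ N / 2\<close>. The closed form satisfies the same recursion,
  and both tend to 0.\<close>

lemma integral_s_kernel_subgroup:
  "(\<integral>x. s_kernel s x * indicator (cantor_subgroup N) x \<partial>H)
    = (2 powr (s - 1)) ^ N / (2 * (1 - 2 powr (s - 1)))"
proof -
  define r :: real where "r = 2 powr (s - 1)"
  have r: "0 < r" "r < 1"
    using ratio_bounds[OF s] by (auto simp: r_def)
  define I where "I N = (\<integral>x. s_kernel s x * indicator (cantor_subgroup N) x \<partial>H)" for N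
  have step: "I N = r ^ N / 2 + I (Suc N)" for N
  proof -
    have "I N = (\<integral>x. 2 powr (s * real N) * (indicator (cantor_subgroup N) x - indicator (cantor_subgroup (Suc N)) x)
        + s_kernel s x * indicator (cantor_subgroup (Suc N)) x \<partial>H)"
      unfolding I_def
      by (intro Bochner_Integration.integral_cong refl)
        (auto simp: indicator_def cantor_subgroup_Suc_iff s_kernel_boundary)
    also have "\<dots> = 2 powr (s * real N) * (1 / 2 ^ N - 1 / 2 ^ Suc N) + I (Suc N)"
      unfolding I_def
      by (subst Bochner_Integration.integral_add)
        (simp_all add: integrable_haar_subgroup integrable_s_kernel_subgroup sets_eq_imp_space_eq[OF sets_haar]
          haar_subgroup_measure)
    also have "2 powr (s * real N) * (1 / 2 ^ N - 1 / 2 ^ Suc N) = r ^ N / 2"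
      unfolding r_def powr_ratio[symmetric] by (simp add: field_simps)
    finally show ?thesis .
  qed
  \<comment> \<open>The discrepancy from the closed form is constant in \<open>N\<close>, so it
    vanishes once its limit is 0.\<close>
  define J where "J N = I N - r ^ N / (2 * (1 - r))" for N
  have "J (Suc N) = J N" for N
    unfolding J_def step[of N] using r by (simp add: field_simps)
  then have const: "J N = J 0" for N
    by (induction N) auto
  have "I \<longlonglongrightarrow> (\<integral>x. 0 \<partial>H)"
    unfolding I_def
  proof (rule integral_dominated_convergence[where w = "s_kernel s"])
    show "integrable H (s_kernel s)"
      by (rule s_kernel_integrable[OF s H])
    show "AE x in H. (\<lambda>N. s_kernel s x * indicator (cantor_subgroup N) x) \<longlonglongrightarrow> 0"
    proof (intro AE_I2)
      fix x
      show "(\<lambda>N. s_kernel s x * indicator (cantor_subgroup N) x) \<longlonglongrightarrow> 0"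
      proof (cases "x = 0")
        case False
        then show ?thesis
          by (intro tendsto_eventually eventually_mono[OF eventually_notin_cantor_subgroup]) auto
      qed simp
    qed
  qed (use s_kernel_suminf(2)[OF s(1)] integrable_s_kernel_subgroup in \<open>auto simp: indicator_def\<close>)
  moreover have "(\<lambda>N. r ^ N / (2 * (1 - r))) \<longlonglongrightarrow> 0 / (2 * (1 - r))"
    using r by (intro tendsto_intros LIMSEQ_power_zero) auto
  ultimately have "J \<longlonglongrightarrow> 0"
    unfolding J_def using tendsto_diff by fastforce
  then have "J 0 = 0"
    using const LIMSEQ_unique[of "\<lambda>_. J 0"] by (metis tendsto_const LIMSEQ_unique ext)
  then show ?thesis
    using const[of N] by (simp add: J_def I_def r_def)
qed

lemma walsh_coeff_0: "walsh_coeff H (s_kernel s) 0 = 1 / (2 * (1 - 2 powr (s - 1)))"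
  using integral_s_kernel_subgroup[of 0] by (simp add: walsh_coeff_def walsh_def cantor_subgroup_def)

text \<open>Off \<open>G_N\<close> the oscillation cancels. On \<open>G_N\<close> the Walsh function
  depends on coordinate \<open>N\<close> alone, so the coefficient is the kernel integral over
  \<open>G_(N+1)\<close> minus that over the shell, independently of \<open>j\<close>.\<close>

lemma walsh_coeff_add_power:
  assumes "j < 2 ^ N"
  shows "walsh_coeff H (s_kernel s) (j + 2 ^ N)
    = (2 powr (s - 1)) ^ N * (2 powr (s - 1) / (2 * (1 - 2 powr (s - 1))) - 1 / 2)"
proof -
  let ?w = "walsh (j + 2 ^ N)" and ?G = cantor_subgroup
  have [measurable]: "walsh k \<in> borel_measurable borel" "s_kernel s \<in> borel_measurable borel"
      "?G n \<in> sets borel" for k n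
    by (simp_all add: walsh_measurable s_kernel_measurable cantor_subgroup_sets)
  define g where "g x = s_kernel s x * (?w x * indicator (- ?G N) x)" for x
  have g_meas [measurable]: "g \<in> borel_measurable borel"
    unfolding g_def by measurable
  have g_int: "integrable H g"
    unfolding g_def[abs_def]
    by (rule integrable_s_kernel_mult) (measurable, simp add: abs_mult abs_walsh indicator_def)
  \<comment> \<open>Translation by this unit vector preserves the complement of \<open>G_N\<close>
    and the kernel there but flips the sign of \<open>?w\<close>. Haar invariance then makes the
    integral of \<open>g\<close> equal to its negative.\<close>
  define e :: cantor where "e = (\<lambda>i. if i = N then 1 else 0)"
  have e: "e \<in> ?G N" "?w e = - 1"
    using assms walsh_eq_1[OF assms, of e]
    by (auto simp: e_def cantor_subgroup_def walsh_add_power)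
  have "g (e + x) = - g x" for x
    using e by (cases "x \<in> ?G N")
      (simp_all add: g_def walsh_add s_kernel_add_left cantor_subgroup_add_left_iff)
  then have g0: "(\<integral>x. g x \<partial>H) = 0"
    using integral_haar_add[OF g_meas, of e] by simp
  have w: "s_kernel s x * ?w x = g x + (s_kernel s x * indicator (?G (Suc N)) x
      - 2 powr (s * real N) * (indicator (?G N) x - indicator (?G (Suc N)) x))" for x
    using walsh_eq_1[OF assms, of x] walsh_add_power[OF assms, of x]
    by (cases "x \<in> ?G N"; cases "x N")
      (auto simp: g_def indicator_def cantor_subgroup_Suc_iff s_kernel_boundary)
  have "walsh_coeff H (s_kernel s) (j + 2 ^ N) = (\<integral>x. s_kernel s x * indicator (?G (Suc N)) x \<partial>H)
      - 2 powr (s * real N) * (1 / 2 ^ N - 1 / 2 ^ Suc N)"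
    unfolding walsh_coeff_def w
    by (simp add: g_int g0 integrable_haar_subgroup integrable_s_kernel_subgroup
        sets_eq_imp_space_eq[OF sets_haar] haar_subgroup_measure)
  also have "2 powr (s * real N) * (1 / 2 ^ N - 1 / 2 ^ Suc N) = (2 powr (s - 1)) ^ N / 2"
    unfolding powr_ratio[symmetric] by (simp add: field_simps)
  finally show ?thesis
    unfolding integral_s_kernel_subgroup by (simp add: algebra_simps)
qed

lemma walsh_coeff_nonneg: "0 \<le> walsh_coeff H (s_kernel s) k"
proof (cases "k = 0")
  case True
  then show ?thesis
    using ratio_bounds[OF s] by (simp add: walsh_coeff_0)
next
  case False
  then obtain N where N: "2 ^ N \<le> k" "k < 2 ^ Suc N"
    using ex_power_ivl1[of 2 k] by auto
  then have k: "k = (k - 2 ^ N) + 2 ^ N" "k - 2 ^ N < 2 ^ N"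
    by auto
  \<comment> \<open>With \<open>r = 2 powr (s - 1)\<close> this says \<open>r / (1 - r)\<close> is
    at least 1, that is, \<open>r\<close> is at least 1/2; positivity of \<open>s\<close> provides
    it.\<close>
  have "0 \<le> 2 powr (s - 1) / (2 * (1 - 2 powr (s - 1))) - 1 / 2"
    using ratio_bounds[OF s] by (simp add: field_simps)
  then show ?thesis
    by (subst k(1)) (simp add: walsh_coeff_add_power[OF k(2)])
qed

text \<open>By induction: a dyadic block has one common coefficient, so it adds a multiple of the
  difference of two consecutive Dirichlet kernels. This changes nothing off \<open>G_N\<close> and
  corrects the average separately on the shell and on \<open>G_(N+1)\<close>.\<close>

lemma walsh_partial_sum:
  "(\<Sum>k<2 ^ N. walsh_coeff H (s_kernel s) k * walsh k z) =
    (if z \<in> cantor_subgroup N then 2 powr (s * real N) / (2 * (1 - 2 powr (s - 1))) else s_kernel s z)"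
proof (induction N)
  case 0
  then show ?case
    by (simp add: walsh_coeff_0 walsh_def cantor_subgroup_def)
next
  case (Suc N)
  define r :: real where "r = 2 powr (s - 1)"
  define c where "c = 1 / (2 * (1 - r))"
  have "r < 1"
    using ratio_bounds[OF s] by (auto simp: r_def)
  \<comment> \<open>This relation settles both cases inside \<open>G_N\<close>: on the shell the new
    value becomes \<open>2 ^ N * r ^ N\<close>, on \<open>G_(N+1)\<close> it becomes
    \<open>2 ^ Suc N * r ^ Suc N * c\<close>.\<close>
  then have rc: "r * c = c - 1 / 2"
    by (simp add: c_def field_simps)
  have rcX: "X * c = X * (r * c) + X / 2" for X
    unfolding rc by (simp add: algebra_simps)
  have c: "x / (2 * (1 - r)) = x * c" for x
    by (simp add: c_def)
  let ?G = "\<lambda>n. indicator (cantor_subgroup n) z :: real"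
  let ?f = "\<lambda>k. walsh_coeff H (s_kernel s) k * walsh k z"
  have split: "(\<Sum>k<2 ^ Suc N. f k) = (\<Sum>k<2 ^ N. f k) + (\<Sum>k<2 ^ N. f (k + 2 ^ N))" for f :: "nat \<Rightarrow> real"
    using sum.shift_bounds_nat_ivl[of f 0 "2 ^ N" "2 ^ N"]
      sum.atLeastLessThan_concat[of 0 "2 ^ N" "2 ^ N + 2 ^ N" f]
    by (simp add: mult_2 lessThan_atLeast0)
  have "(\<Sum>k<2 ^ N. ?f (k + 2 ^ N)) = r ^ N * (r / (2 * (1 - r)) - 1 / 2) * (\<Sum>k<2 ^ N. walsh (k + 2 ^ N) z)"
    by (simp add: walsh_coeff_add_power sum_distrib_left r_def)
  also have "(\<Sum>k<2 ^ N. walsh (k + 2 ^ N) z) = 2 ^ Suc N * ?G (Suc N) - 2 ^ N * ?G N"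
    using split[of "\<lambda>k. walsh k z"] by (simp only: dirichlet)
  finally have eq: "(\<Sum>k<2 ^ Suc N. ?f k) = (\<Sum>k<2 ^ N. ?f k)
      + r ^ N * (r / (2 * (1 - r)) - 1 / 2) * (2 ^ Suc N * ?G (Suc N) - 2 ^ N * ?G N)"
    unfolding split[of ?f] by simp
  have p: "2 powr (s * real N) = 2 ^ N * r ^ N" for N
    unfolding r_def powr_ratio[symmetric] by simp
  show ?case
    unfolding eq Suc.IH p r_def[symmetric] c rc
    using rcX[of "2 ^ N * r ^ N"]
    by (auto simp: cantor_subgroup_Suc_iff indicator_def s_kernel_boundary p algebra_simps)
qed

end

section \<open>Energy and Walsh coefficients as integrals over the product measure\<close>

lemma measurable_cantor_diff [measurable]:
  "(\<lambda>p :: cantor \<times> cantor. fst p - snd p) \<in> borel \<Otimes>\<^sub>M borel \<rightarrow>\<^sub>M borel"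
proof -
  have "(\<lambda>p :: cantor \<times> cantor. fst p - snd p) \<in> borel \<Otimes>\<^sub>M borel \<rightarrow>\<^sub>M PiM UNIV (\<lambda>_. borel)"
  proof (rule measurable_PiM_single')
    \<comment> \<open>Measurability is checked by coordinates. Every set of bits is Borel, so the
      Borel and discrete structures on \<open>bit\<close> can be exchanged.\<close>
    fix i :: nat
    have coord [measurable]: "(\<lambda>x :: cantor. x i) \<in> borel \<rightarrow>\<^sub>M count_space UNIV"
      using borel_measurable_coordinate[of id i] by (simp add: measurable_def sets_bit_borel)
    have "(\<lambda>p :: cantor \<times> cantor. fst p i - snd p i) \<in> borel \<Otimes>\<^sub>M borel \<rightarrow>\<^sub>M count_space UNIV"
      by measurable
    then show "(\<lambda>p :: cantor \<times> cantor. (fst p - snd p) i) \<in> borel \<Otimes>\<^sub>M borel \<rightarrow>\<^sub>M borel"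
      by (simp add: measurable_def sets_bit_borel)
  qed auto
  then show ?thesis
    using measurable_cong_sets[OF refl sets_cantor_borel] by blast
qed

lemma singleton_cantor_borel: "{x :: cantor} \<in> sets borel"
proof -
  \<comment> \<open>The subgroups intersect in 0 alone, and \<open>x + y\<close> is
    \<open>x - y\<close>.\<close>
  have "{x} = (\<Inter>n. (\<lambda>y. x + y) -` cantor_subgroup n)"
  proof (intro equalityI subsetI)
    fix y assume "y \<in> (\<Inter>n. (\<lambda>y. x + y) -` cantor_subgroup n)"
    then have "(x - y) i = 0 i" for i
      by (auto simp: cantor_diff_eq_add cantor_subgroup_def)
    then have "x - y = 0"
      by (rule ext)
    then show "y \<in> {x}"
      by simp
  next
    fix y assume "y \<in> {x}"
    then show "y \<in> (\<Inter>n. (\<lambda>y. x + y) -` cantor_subgroup n)"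
      by (simp add: cantor_subgroup_def)
  qed
  moreover have "(\<lambda>y. x + y) -` cantor_subgroup n \<in> sets borel" for n
    using measurable_sets[OF measurable_cantor_add cantor_subgroup_sets] by simp
  ultimately show ?thesis
    by (auto intro!: sets.countable_INT)
qed

context
  fixes \<mu> :: "cantor measure"
  assumes \<mu>: "mass_distribution \<mu>"
begin

lemma sets_mass [measurable_cong]: "sets \<mu> = sets borel"
  using \<mu> by (simp add: mass_distribution_def)

lemma finite_mass: "finite_measure \<mu>"
  using \<mu> by (simp add: mass_distribution_def)

lemma measurable_diff_compose:
  "f \<in> borel \<rightarrow>\<^sub>M N \<Longrightarrow> (\<lambda>p. f (fst p - snd p)) \<in> \<mu> \<Otimes>\<^sub>M \<mu> \<rightarrow>\<^sub>M N"
  using measurable_compose[OF measurable_cantor_diff]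
    measurable_cong_sets[OF sets_pair_measure_cong[OF sets_mass sets_mass] refl] by blast

lemma s_energy_eq_nn_integral_pair:
  "s_energy s \<mu> = (\<integral>\<^sup>+ p. ennreal (s_kernel s (fst p - snd p)) \<partial>(\<mu> \<Otimes>\<^sub>M \<mu>))"
proof -
  interpret finite_measure \<mu> by (rule finite_mass)
  have [measurable]: "s_kernel s \<in> borel_measurable borel"
    by (rule s_kernel_measurable)
  show ?thesis
    unfolding s_energy_def s_potential_def
    by (subst nn_integral_fst[symmetric])
      (simp_all add: measurable_diff_compose[of "\<lambda>z. ennreal (s_kernel s z)"])
qed

lemma integrable_walsh_diff: "integrable (\<mu> \<Otimes>\<^sub>M \<mu>) (\<lambda>p. walsh k (fst p - snd p))"
proof -
  interpret P: finite_measure "\<mu> \<Otimes>\<^sub>M \<mu>"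
    by (intro finite_measure_pair_measure finite_mass)
  show ?thesis
    by (rule P.integrable_const_bound[where B = 1])
      (simp_all add: abs_walsh measurable_diff_compose walsh_measurable)
qed

text \<open>Fubini applies because Walsh functions are bounded and the measure is finite;
  multiplicativity then separates the two variables.\<close>

lemma walsh_coeff_measure_square:
  "(walsh_coeff_measure \<mu> k)\<^sup>2 = (\<integral>p. walsh k (fst p - snd p) \<partial>(\<mu> \<Otimes>\<^sub>M \<mu>))"
proof -
  interpret finite_measure \<mu> by (rule finite_mass)
  interpret P: pair_sigma_finite \<mu> \<mu> ..
  have "(\<integral>p. walsh k (fst p - snd p) \<partial>(\<mu> \<Otimes>\<^sub>M \<mu>)) = (\<integral>x. (\<integral>y. walsh k (x - y) \<partial>\<mu>) \<partial>\<mu>)"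
    using P.integral_fst'[OF integrable_walsh_diff[of k]] by simp
  also have "\<dots> = (walsh_coeff_measure \<mu> k)\<^sup>2"
    by (simp add: cantor_diff_eq_add walsh_add walsh_coeff_measure_def power2_eq_square)
  finally show ?thesis
    by simp
qed

text \<open>The section of the diagonal over \<open>x\<close> is \<open>{x}\<close>, which is null.
  This excludes the point 0, where the averages grow without bound while the kernel is 0.\<close>

lemma AE_off_diagonal:
  assumes "\<And>x. emeasure \<mu> {x} = 0"
  shows "AE p in \<mu> \<Otimes>\<^sub>M \<mu>. fst p - snd p \<noteq> 0"
proof -
  interpret finite_measure \<mu> by (rule finite_mass)
  interpret P: pair_sigma_finite \<mu> \<mu> ..
  have "Measurable.pred (\<mu> \<Otimes>\<^sub>M \<mu>) (\<lambda>p. fst p - snd p \<noteq> 0)"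
    using singleton_cantor_borel[of 0]
    by (intro measurable_diff_compose[of "\<lambda>z. z \<noteq> 0"] pred_intros_logic) (simp add: pred_def)
  moreover have "AE y in \<mu>. x - y \<noteq> 0" for x
    using assms[of x] singleton_cantor_borel[of x]
    by (intro AE_I[where N = "{x}"]) (auto simp: sets_mass)
  ultimately show ?thesis
    by (intro P.AE_pair_measure) (auto simp: pred_def)
qed

end

section \<open>Passage to the limit in the energy series\<close>

theorem theorem2:
  fixes s :: real and H \<mu> :: "cantor measure"
  assumes "0 < s" "s < 1"
    and "normalized_haar H"
    and "mass_distribution \<mu>"
    and "(\<forall>x. emeasure \<mu> {x} = 0) \<or> s_energy s \<mu> = \<infinity>"
  shows "(\<lambda>k. ereal (walsh_coeff H (s_kernel s) k * (walsh_coeff_measure \<mu> k)\<^sup>2))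
    sums enn2ereal (s_energy s \<mu>)"
proof -
  note s = assms(1,2) and H = assms(3) and \<mu> = assms(4)
  define a where "a k = walsh_coeff H (s_kernel s) k * (walsh_coeff_measure \<mu> k)\<^sup>2" for k
  define c where "c = 1 / (2 * (1 - 2 powr (s - 1)))"
  define P where "P N z = (\<Sum>k<2 ^ N. walsh_coeff H (s_kernel s) k * walsh k z)" for N z
  let ?M = "\<mu> \<Otimes>\<^sub>M \<mu>" and ?d = "\<lambda>p :: cantor \<times> cantor. fst p - snd p"
  note [measurable_cong] = sets_mass[OF \<mu>]
  have c: "1 \<le> c"
    using ratio_bounds[OF s] by (simp add: c_def field_simps)
  have P: "P N z = (if z \<in> cantor_subgroup N then c * 2 powr (s * real N) else s_kernel s z)" for N z
    unfolding P_def walsh_partial_sum[OF H s] c_def by simp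
  have P_nonneg: "0 \<le> P N z" for N z
    using c s_kernel_suminf(2)[OF s(1), of z] by (simp add: P)
  \<comment> \<open>On \<open>G_N\<close> this is \<open>s_kernel_ge\<close> multiplied by
    \<open>c\<close>; off \<open>G_N\<close> it is the bound 1 \<le> \<open>c\<close>.\<close>
  have P_le: "P N z \<le> c * s_kernel s z" if "z \<noteq> 0" for N z
    using c s_kernel_ge[OF s(1), of z N] s_kernel_suminf(2)[OF s(1), of z] that
    by (auto simp: P mult_left_mono mult_le_cancel_right1)
  \<comment> \<open>A nonzero \<open>z\<close> eventually leaves \<open>G_N\<close>, after which the
    sequence equals the kernel value.\<close>
  have P_lim: "(\<lambda>N. ennreal (P N z)) \<longlonglongrightarrow> ennreal (s_kernel s z)" if "z \<noteq> 0" for z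
    by (rule tendsto_eventually, rule eventually_mono[OF eventually_notin_cantor_subgroup[OF that]])
      (simp add: P)
  have [measurable]: "walsh k \<in> borel_measurable borel" "s_kernel s \<in> borel_measurable borel" for k
    by (simp_all add: walsh_measurable s_kernel_measurable)
  have [measurable]: "P N \<in> borel_measurable borel" for N
    unfolding P_def[abs_def] by measurable
  have P_meas: "(\<lambda>p. ennreal (P N (?d p))) \<in> borel_measurable ?M" for N
    by (rule measurable_diff_compose[OF \<mu>]) measurable
  have kernel_meas: "(\<lambda>p. ennreal (s_kernel s (?d p))) \<in> borel_measurable ?M"
      "(\<lambda>p. ennreal (c * s_kernel s (?d p))) \<in> borel_measurable ?M"
    using measurable_diff_compose[OF \<mu>, of "\<lambda>z. ennreal (s_kernel s z)" borel]
      measurable_diff_compose[OF \<mu>, of "\<lambda>z. ennreal (c * s_kernel s z)" borel]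
    by simp_all
  have a_nonneg: "0 \<le> a k" for k
    using walsh_coeff_nonneg[OF H s] by (simp add: a_def)
  have partial: "ennreal (\<Sum>k<2 ^ N. a k) = (\<integral>\<^sup>+ p. ennreal (P N (?d p)) \<partial>?M)" for N
  proof -
    have "(\<Sum>k<2 ^ N. a k) = (\<integral>p. P N (?d p) \<partial>?M)"
      unfolding a_def P_def walsh_coeff_measure_square[OF \<mu>]
      by (subst Bochner_Integration.integral_sum) (simp_all add: integrable_walsh_diff[OF \<mu>])
    moreover have "integrable ?M (\<lambda>p. P N (?d p))"
      unfolding P_def
      by (intro Bochner_Integration.integrable_sum integrable_mult_right integrable_walsh_diff[OF \<mu>])
    ultimately show ?thesis
      by (simp add: nn_integral_eq_integral P_nonneg)
  qed
  have "(\<lambda>N. \<integral>\<^sup>+ p. ennreal (P N (?d p)) \<partial>?M) \<longlonglongrightarrow> s_energy s \<mu>"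
  proof (cases "s_energy s \<mu> = \<infinity>")
    case True
    \<comment> \<open>At 0 the kernel vanishes, so the one-sided bound that Fatou needs holds on the
      diagonal too.\<close>
    have "ennreal (s_kernel s z) \<le> liminf (\<lambda>N. ennreal (P N z))" for z
      by (cases "z = 0") (simp_all add: lim_imp_Liminf[OF _ P_lim])
    then have "s_energy s \<mu> \<le> (\<integral>\<^sup>+ p. liminf (\<lambda>N. ennreal (P N (?d p))) \<partial>?M)"
      unfolding s_energy_eq_nn_integral_pair[OF \<mu>] by (intro nn_integral_mono)
    also have "\<dots> \<le> liminf (\<lambda>N. \<integral>\<^sup>+ p. ennreal (P N (?d p)) \<partial>?M)"
      by (rule nn_integral_liminf) (rule P_meas)
    finally have "liminf (\<lambda>N. \<integral>\<^sup>+ p. ennreal (P N (?d p)) \<partial>?M) = \<infinity>"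
      using True by (simp add: top_unique)
    then show ?thesis
      using True Liminf_le_Limsup[of sequentially "\<lambda>N. \<integral>\<^sup>+ p. ennreal (P N (?d p)) \<partial>?M"]
      by (intro Liminf_eq_Limsup) (auto simp: top_unique)
  next
    \<comment> \<open>Finite energy leaves the atomless alternative, and it also makes the
      dominating function \<open>c * s_kernel s (x - y)\<close> integrable.\<close>
    case False
    with assms(5) have off: "AE p in ?M. ?d p \<noteq> 0"
      by (intro AE_off_diagonal[OF \<mu>]) auto
    show ?thesis
      unfolding s_energy_eq_nn_integral_pair[OF \<mu>]
    proof (rule nn_integral_dominated_convergence[where w = "\<lambda>p. ennreal (c * s_kernel s (?d p))"])
      have "(\<integral>\<^sup>+ p. ennreal (c * s_kernel s (?d p)) \<partial>?M) = ennreal c * s_energy s \<mu>"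
        unfolding s_energy_eq_nn_integral_pair[OF \<mu>]
        using c by (subst nn_integral_cmult[symmetric]) (simp_all add: kernel_meas ennreal_mult')
      then show "(\<integral>\<^sup>+ p. ennreal (c * s_kernel s (?d p)) \<partial>?M) < \<infinity>"
        using False by (simp add: ennreal_mult_less_top less_top)
      show "AE p in ?M. ennreal (P N (?d p)) \<le> ennreal (c * s_kernel s (?d p))" for N
        using off by eventually_elim (intro ennreal_leI P_le)
      show "AE p in ?M. (\<lambda>N. ennreal (P N (?d p))) \<longlonglongrightarrow> ennreal (s_kernel s (?d p))"
        using off by eventually_elim (rule P_lim)
    qed (fact P_meas kernel_meas)+
  qed
  then have "(\<lambda>N. ennreal (\<Sum>k<2 ^ N. a k)) \<longlonglongrightarrow> s_energy s \<mu>"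
    by (simp add: partial)
  then have "(\<lambda>N. enn2ereal (ennreal (\<Sum>k<2 ^ N. a k))) \<longlonglongrightarrow> enn2ereal (s_energy s \<mu>)"
    by (rule tendsto_enn2erealI)
  then have lim: "(\<lambda>N. \<Sum>k<2 ^ N. ereal (a k)) \<longlonglongrightarrow> enn2ereal (s_energy s \<mu>)"
    by (simp add: sum_nonneg a_nonneg)
  \<comment> \<open>Nonnegative terms give a sum in the extended reals, and its value is identified
    along the subsequence \<open>2 ^ N\<close>.\<close>
  have sums: "(\<lambda>k. ereal (a k)) sums (\<Sum>k. ereal (a k))"
    using a_nonneg by (intro summable_sums summable_ereal_pos) simp
  have "filterlim (\<lambda>N :: nat. 2 ^ N :: nat) sequentially sequentially"
    by (rule filterlim_at_top_mono[OF filterlim_ident]) (simp add: less_imp_le)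
  then have "(\<lambda>N. \<Sum>k<2 ^ N. ereal (a k)) \<longlonglongrightarrow> (\<Sum>k. ereal (a k))"
    using filterlim_compose[OF sums[unfolded sums_def]] by blast
  with lim sums have "(\<lambda>k. ereal (a k)) sums enn2ereal (s_energy s \<mu>)"
    using LIMSEQ_unique by metis
  then show ?thesis
    by (simp only: a_def)
qed

end
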